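(* Let $d\ge 2$, $\alpha>0$, $\kappa\in\mathbb R$, $\mu\in\mathbb S^{d-1}$, and let the random unit vector $Z\in\mathbb S^{d-1}$ have the distribution $\mathrm{GvMF}_{2,d}(\alpha,\kappa,\mu)$. Then $Z$ has the maximum entropy among all continuous random vectors $X$ on $\mathbb S^{d-1}$ (i.e. having a density with respect to $\sigma$) satisfying $$\mathbf E\|X-\mu\|^{2\alpha}=\mathbf E\|Z-\mu\|^{2\alpha};$$ that is, $H(X)\le H(Z)$ for every such $X$.
   Context: $\mathbb S^{d-1}=\{x\in\mathbb R^d:\|x\|=1\}$ and $\sigma$ is the (unnormalized) surface measure on $\mathbb S^{d-1}$, so that for unit $a$ and Borel $g\ge0$, $\int_{\mathbb S^{d-1}}g(a^{T}x)\,\sigma(dx)=\frac{2\pi^{(d-1)/2}}{\Gamma((d-1)/2)}\int_{-1}^1g(y)(1-y^2)^{(d-3)/2}dy$. $\mathrm{GvMF}_{2,d}(\alpha,\kappa,\mu)$ is the distribution on $\mathbb S^{d-1}$ with density with respect to $\sigma$ equal to $c_{2,d}(\kappa,\alpha)\exp\left(-\frac{\kappa}{2^\alpha\alpha}\|x-\mu\|^{2\alpha}\right)$, where $c_{2,d}(\kappa,\alpha)=\left(\frac{2\pi^{(d-1)/2}}{\Gamma((d-1)/2)}\int_0^1\left(e^{-\frac\kappa\alpha (1-y)^\alpha}+e^{-\frac\kappa\alpha (1+y)^\alpha}\right)(1-y^2)^{\frac{d-3}{2}}dy\right)^{-1}$. The entropy of a random vector $X$ on $\mathbb S^{d-1}$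 with density $f$ with respect to $\sigma$ is $H(X)=-\int_{\mathbb S^{d-1}}f(x)\log f(x)\,\sigma(dx)\in[-\infty,\infty)$, the integral being taken over $\{f>0\}$. *)

theory Defs
  imports "HOL-Probability.Probability"
begin

(* Surface measure on the unit sphere of a d-dimensional Euclidean space, as the cone measure
     sigma A = d * vol {r x | x : A, 0 < r < 1},
   i.e. d times the image of Lebesgue measure on the punctured unit ball under x |-> x / |x|. *)
definition sphere_measure :: "'a::euclidean_space measure" where
  "sphere_measure =
     scale_measure (of_nat DIM('a))
       (distr (restrict_space lborel (ball 0 1 - {0})) (restrict_space borel (sphere 0 1))
          (\<lambda>x. x /\<^sub>R norm x))"

lemma space_sphere_measure [simp]: "space sphere_measure = sphere (0::'a::euclidean_space) 1"
  by (simp add: sphere_measure_def space_scale_measure space_restrict_space)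

lemma sets_sphere_measure [measurable_cong, simp]:
  "sets sphere_measure = sets (restrict_space borel (sphere (0::'a::euclidean_space) 1))"
  by (simp add: sphere_measure_def)

lemma normalize_measurable:
  "(\<lambda>x. x /\<^sub>R norm x) \<in>
     restrict_space lborel (ball 0 1 - {0}) \<rightarrow>\<^sub>M restrict_space borel (sphere (0::'a::euclidean_space) 1)"
  by (rule measurable_restrict_space2)
     (auto simp: space_restrict_space intro!: measurable_restrict_space1)

lemma emeasure_sphere_measure:
  assumes "A \<in> sets (restrict_space borel (sphere (0::'a::euclidean_space) 1))"
  shows "emeasure sphere_measure A =
           of_nat DIM('a) * emeasure lborel {x \<in> ball 0 1 - {0}. x /\<^sub>R norm x \<in> A}"
proof -
  have "emeasure (distr (restrict_space lborel (ball 0 1 - {0})) (restrict_space borel (sphere (0::'a) 1))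
          (\<lambda>x. x /\<^sub>R norm x)) A =
        emeasure (restrict_space lborel (ball 0 1 - {0}))
          {x \<in> ball 0 1 - {0}. x /\<^sub>R norm x \<in> A}"
    using assms
    by (subst emeasure_distr[OF normalize_measurable])
       (auto simp: space_restrict_space intro!: arg_cong2[where f=emeasure])
  also have "\<dots> = emeasure lborel {x \<in> ball 0 1 - {0}. x /\<^sub>R norm x \<in> A}"
    by (subst emeasure_restrict_space) auto
  finally show ?thesis
    by (simp add: sphere_measure_def)
qed

lemma finite_measure_sphere_measure:
  "finite_measure (sphere_measure :: 'a::euclidean_space measure)"
proof
  have eq: "{x \<in> ball 0 1 - {0}. x /\<^sub>R norm x \<in> sphere (0::'a) 1} = ball 0 1 - {0}"
    by auto
  have "sphere (0::'a) 1 \<in> sets (restrict_space borel (sphere (0::'a) 1))"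
    by (metis sets.top space_restrict_space2 space_sphere_measure sets_sphere_measure)
  then have "emeasure sphere_measure (sphere (0::'a) 1) =
      of_nat DIM('a) * emeasure lborel (ball (0::'a) 1 - {0})"
    by (simp only: emeasure_sphere_measure eq)
  also have "emeasure lborel (ball (0::'a) 1 - {0}) \<le> emeasure lborel (ball (0::'a) 1)"
    by (rule emeasure_mono) auto
  then have "of_nat DIM('a) * emeasure lborel (ball (0::'a) 1 - {0}) < \<infinity>"
    using emeasure_lborel_ball_finite[of "0::'a" 1]
    by (auto simp: ennreal_mult_less_top of_nat_less_top)
  finally show "emeasure (sphere_measure :: 'a measure) (space sphere_measure) \<noteq> \<infinity>"
    by simp
qed

definition gvmf2_const :: "nat \<Rightarrow> real \<Rightarrow> real \<Rightarrow> real" where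
  "gvmf2_const d \<kappa> \<alpha> =
     inverse (2 * pi powr ((real d - 1) / 2) / Gamma ((real d - 1) / 2) *
       (LINT y:{0..1}|lborel.
          (exp (- (\<kappa> / \<alpha>) * (1 - y) powr \<alpha>) + exp (- (\<kappa> / \<alpha>) * (1 + y) powr \<alpha>)) *
          (1 - y\<^sup>2) powr ((real d - 3) / 2)))"

definition gvmf2_density :: "real \<Rightarrow> real \<Rightarrow> 'a::euclidean_space \<Rightarrow> 'a \<Rightarrow> real" where
  "gvmf2_density \<alpha> \<kappa> \<mu> x =
     gvmf2_const DIM('a) \<kappa> \<alpha> * exp (- (\<kappa> / (2 powr \<alpha> * \<alpha>)) * norm (x - \<mu>) powr (2 * \<alpha>))"

(* The functional - \<integral> f ln f, as positive part minus negative part. Since - t ln t \<le> 1/e and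
   the surface measure is finite, the first integral is finite, so the value lies in
   [-\<infinity>, \<infinity>) and no \<infinity> - \<infinity> occurs. Points with f x = 0 contribute 0 because 0 * ln 0 = 0.
   The library constant entropy is real-valued (a non-integrable f ln f does not give -\<infinity>
   there), which is why it is not used. *)
definition density_entropy :: "('a::euclidean_space \<Rightarrow> ennreal) \<Rightarrow> ereal" where
  "density_entropy f =
     enn2ereal (\<integral>\<^sup>+x. ennreal (- (enn2real (f x) * ln (enn2real (f x)))) \<partial>sphere_measure) -
     enn2ereal (\<integral>\<^sup>+x. ennreal (enn2real (f x) * ln (enn2real (f x))) \<partial>sphere_measure)"

(* The choice of the density, here the Radon-Nikodym derivative, is immaterial:
   see sphere_entropy_eq. *)
definition sphere_entropy :: "'b measure \<Rightarrow> ('b \<Rightarrow> 'a::euclidean_space) \<Rightarrow> ereal" where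
  "sphere_entropy M X = density_entropy (RN_deriv sphere_measure (distr M sphere_measure X))"

lemma density_entropy_cong_AE:
  assumes "AE x in sphere_measure. f x = g x"
  shows "density_entropy f = density_entropy g"
proof -
  have "(\<integral>\<^sup>+x. ennreal (- (enn2real (f x) * ln (enn2real (f x)))) \<partial>sphere_measure) =
        (\<integral>\<^sup>+x. ennreal (- (enn2real (g x) * ln (enn2real (g x)))) \<partial>sphere_measure)"
    by (rule nn_integral_cong_AE) (use assms in eventually_elim, simp)
  moreover have "(\<integral>\<^sup>+x. ennreal (enn2real (f x) * ln (enn2real (f x))) \<partial>sphere_measure) =
        (\<integral>\<^sup>+x. ennreal (enn2real (g x) * ln (enn2real (g x))) \<partial>sphere_measure)"
    by (rule nn_integral_cong_AE) (use assms in eventually_elim, simp)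
  ultimately show ?thesis
    by (simp add: density_entropy_def)
qed

lemma sphere_entropy_eq:
  fixes X :: "'b \<Rightarrow> 'a::euclidean_space"
  assumes "distributed M sphere_measure X f"
  shows "sphere_entropy M X = density_entropy f"
proof -
  interpret finite_measure "sphere_measure :: 'a measure"
    by (rule finite_measure_sphere_measure)
  have "AE x in sphere_measure. f x = RN_deriv sphere_measure (distr M sphere_measure X) x"
    using assms by (intro RN_deriv_unique) (auto simp: distributed_def)
  then show ?thesis
    unfolding sphere_entropy_def by (intro density_entropy_cong_AE) (auto elim: eventually_mono)
qed

end

theory Submission
  imports Defs
begin

text \<open>
  This is the maximum entropy principle for exponential families. Write
  \<open>w x = norm (x - \<mu>) powr (2 * \<alpha>)\<close> and let \<open>g\<close> be the density of \<open>Z\<close>. The logarithm of \<open>g\<close>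
  is an affine function \<open>a + b * w\<close> of the constrained statistic, so the cross entropy
  \<open>- \<integral> f ln g\<close> of a competing density \<open>f\<close> depends on \<open>f\<close> only through its total mass and the
  moment \<open>\<integral> f w\<close>. Both agree for \<open>f\<close> and \<open>g\<close>, so the cross entropy of every competitor equals
  \<open>- \<integral> g ln g = H(Z)\<close>, and Gibbs' inequality bounds \<open>H(X)\<close> by the cross entropy
  (\<open>density_entropy_le_cross_entropy\<close>).

  Two points remain. The entropy of \<open>X\<close> may be \<open>-\<infinity>\<close>, which happens exactly when \<open>f ln f\<close> is not
  integrable (\<open>density_entropy_not_integrable\<close>), and then the claim is trivial. The
  normalising constant never has to be evaluated: as \<open>g\<close> is assumed to be a probability density,
  the constant is positive, so \<open>ln g\<close> is defined everywhere. All moments of \<open>w\<close> are finite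
  because \<open>w\<close> is bounded on the sphere.
\<close>

lemma neg_mult_ln_le:
  fixes s t :: real
  assumes "s \<ge> 0" "t > 0"
  shows "- (s * ln s) \<le> - (s * ln t) + t - s"
proof (cases "s = 0")
  case False
  with assms have s: "s > 0" by simp
  have "ln (t / s) \<le> t / s - 1"
    using s assms by (intro ln_le_minus_one) simp
  then have "s * (ln t - ln s) \<le> s * (t / s - 1)"
    using s assms by (intro mult_left_mono) (auto simp: ln_div)
  then show ?thesis
    using s by (simp add: algebra_simps)
qed (use assms in simp)

lemma density_entropy_integrable:
  fixes f :: "'a::euclidean_space \<Rightarrow> ennreal"
  assumes "integrable sphere_measure (\<lambda>x. enn2real (f x) * ln (enn2real (f x)))"
  shows "density_entropy f = ereal (- (\<integral>x. enn2real (f x) * ln (enn2real (f x)) \<partial>sphere_measure))"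
proof -
  let ?h = "\<lambda>x. enn2real (f x) * ln (enn2real (f x))"
  obtain p q where
    p: "(\<integral>\<^sup>+x. ennreal (?h x) \<partial>sphere_measure) = ennreal p" "p \<ge> 0" and
    q: "(\<integral>\<^sup>+x. ennreal (- ?h x) \<partial>sphere_measure) = ennreal q" "q \<ge> 0" and
    "(\<integral>x. ?h x \<partial>sphere_measure) = p - q"
    using assms by (rule integrableE)
  then show ?thesis
    by (simp add: density_entropy_def enn2ereal_ennreal)
qed

text \<open>
  The sphere has finite area and \<open>- t * ln t \<le> 1\<close>, so the positive part of \<open>- f ln f\<close> always has
  a finite integral. Hence only the negative part can prevent integrability.
\<close>

lemma density_entropy_not_integrable:
  fixes f :: "'a::euclidean_space \<Rightarrow> ennreal"
  assumes [measurable]: "f \<in> borel_measurable sphere_measure"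
    and nint: "\<not> integrable sphere_measure (\<lambda>x. enn2real (f x) * ln (enn2real (f x)))"
  shows "density_entropy f = - \<infinity>"
proof -
  let ?h = "\<lambda>x. enn2real (f x) * ln (enn2real (f x))"
  interpret finite_measure "sphere_measure :: 'a measure"
    by (rule finite_measure_sphere_measure)
  have "- ?h x \<le> 1" for x
    using neg_mult_ln_le[of "enn2real (f x)" 1] enn2real_nonneg[of "f x"]
    unfolding ln_one by linarith
  then have "(\<integral>\<^sup>+x. ennreal (- ?h x) \<partial>sphere_measure) \<le> (\<integral>\<^sup>+x. 1 \<partial>(sphere_measure :: 'a measure))"
    by (intro nn_integral_mono) (simp flip: ennreal_1 del: ennreal_1)
  also have "\<dots> < \<infinity>"
    using emeasure_finite[of "space sphere_measure"] by (simp add: less_top[symmetric])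
  finally have pos: "(\<integral>\<^sup>+x. ennreal (- ?h x) \<partial>sphere_measure) < \<infinity>" .
  then have neg: "(\<integral>\<^sup>+x. ennreal (?h x) \<partial>sphere_measure) = \<infinity>"
    using nint by (auto simp: real_integrable_def)
  obtain q where "(\<integral>\<^sup>+x. ennreal (- ?h x) \<partial>sphere_measure) = ennreal q" "q \<ge> 0"
    using pos by (auto simp: less_top_ennreal)
  then show ?thesis
    using neg by (simp add: density_entropy_def enn2ereal_ennreal)
qed

text \<open>
  Gibbs' inequality: integrate the pointwise bound \<open>neg_mult_ln_le\<close>; the correction \<open>g - f\<close> has
  integral zero because both densities have the same mass.
\<close>

lemma density_entropy_le_cross_entropy:
  fixes f :: "'a::euclidean_space \<Rightarrow> ennreal" and g :: "'a \<Rightarrow> real"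
  assumes f: "f \<in> borel_measurable sphere_measure"
      "integrable sphere_measure (\<lambda>x. enn2real (f x))"
    and g: "integrable sphere_measure g" "\<And>x. g x > 0"
    and mass: "(\<integral>x. enn2real (f x) \<partial>sphere_measure) = (\<integral>x. g x \<partial>sphere_measure)"
    and cross: "integrable sphere_measure (\<lambda>x. enn2real (f x) * ln (g x))"
  shows "density_entropy f \<le> ereal (- (\<integral>x. enn2real (f x) * ln (g x) \<partial>sphere_measure))"
proof (cases "integrable sphere_measure (\<lambda>x. enn2real (f x) * ln (enn2real (f x)))")
  case True
  have "(\<integral>x. - (enn2real (f x) * ln (enn2real (f x))) \<partial>sphere_measure) \<le>
      (\<integral>x. - (enn2real (f x) * ln (g x)) + g x - enn2real (f x) \<partial>sphere_measure)"
    using True f g(1) cross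
    by (intro integral_mono neg_mult_ln_le[OF enn2real_nonneg g(2)]) auto
  also have "\<dots> = - (\<integral>x. enn2real (f x) * ln (g x) \<partial>sphere_measure)"
    using f g cross mass by simp
  finally show ?thesis
    using True by (simp add: density_entropy_integrable)
qed (simp add: density_entropy_not_integrable f)

text \<open>
  A probability density with values in \<open>ennreal\<close> is finite almost everywhere, so it can be replaced by a
  real one.
\<close>

lemma distributed_enn2real:
  assumes "prob_space M" and X: "distributed M S X f"
  shows "distributed M S X (\<lambda>x. ennreal (enn2real (f x)))"
proof -
  interpret prob_space M by fact
  have [measurable]: "f \<in> borel_measurable S" "X \<in> M \<rightarrow>\<^sub>M S"
    and distr: "distr M S X = density S f"
    using X by (auto simp: distributed_def)
  interpret X: prob_space "distr M S X"
    by (rule prob_space_distr) fact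
  have "(\<integral>\<^sup>+x. f x \<partial>S) = emeasure (density S f) (space S)"
    by (simp add: emeasure_density cong: nn_integral_cong)
  also have "\<dots> = 1"
    using X.emeasure_space_1 by (simp add: distr)
  finally have "AE x in S. f x \<noteq> \<infinity>"
    by (intro nn_integral_PInf_AE) auto
  then have "AE x in S. f x = ennreal (enn2real (f x))"
    by eventually_elim (simp add: less_top)
  then have "density S f = density S (\<lambda>x. ennreal (enn2real (f x)))"
    by (intro density_cong) auto
  then show ?thesis
    by (simp add: distributed_def distr)
qed

lemma distributed_has_bochner_integral_bounded:
  fixes g :: "'a \<Rightarrow> real" and h :: "'a \<Rightarrow> real"
  assumes "prob_space M" and X: "distributed M S X (\<lambda>x. ennreal (g x))"
    and g: "g \<in> borel_measurable S" "\<And>x. g x \<ge> 0"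
    and h: "h \<in> borel_measurable S" "\<And>x. x \<in> space S \<Longrightarrow> \<bar>h x\<bar> \<le> B"
  shows "has_bochner_integral S (\<lambda>x. g x * h x) (\<integral>w. h (X w) \<partial>M)"
proof -
  interpret prob_space M by fact
  have [measurable]: "X \<in> M \<rightarrow>\<^sub>M S"
    using X by (auto simp: distributed_def)
  have "integrable M (\<lambda>w. h (X w))"
    using h by (intro integrable_const_bound[where B = B] AE_I2)
      (auto intro: measurable_space[OF \<open>X \<in> M \<rightarrow>\<^sub>M S\<close>])
  then have "integrable S (\<lambda>x. g x * h x)"
    using distributed_integrable[OF X h(1)] g by auto
  moreover have "(\<integral>x. g x * h x \<partial>S) = (\<integral>w. h (X w) \<partial>M)"
    using distributed_integral[OF X h(1)] g by auto
  ultimately show ?thesis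
    by (simp add: has_bochner_integral_iff)
qed

theorem theorem4p3:
  fixes \<alpha> \<kappa> :: real and \<mu> :: "real ^ 'd"
    and N :: "'c measure" and Z :: "'c \<Rightarrow> real ^ 'd"
    and M :: "'b measure" and X :: "'b \<Rightarrow> real ^ 'd" and f :: "real ^ 'd \<Rightarrow> ennreal"
  assumes "CARD('d) \<ge> 2"
    and "\<alpha> > 0"
    and "\<mu> \<in> sphere 0 1"
    and "prob_space N"
    and "distributed N sphere_measure Z (\<lambda>x. ennreal (gvmf2_density \<alpha> \<kappa> \<mu> x))"
    and "prob_space M"
    and "distributed M sphere_measure X f"
    and "prob_space.expectation M (\<lambda>w. norm (X w - \<mu>) powr (2 * \<alpha>)) =
         prob_space.expectation N (\<lambda>w. norm (Z w - \<mu>) powr (2 * \<alpha>))"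
  shows "sphere_entropy M X \<le> sphere_entropy N Z"
proof -
  let ?S = "sphere_measure :: (real ^ 'd) measure"
  interpret M: prob_space M by fact
  interpret N: prob_space N by fact
  define w :: "real ^ 'd \<Rightarrow> real" where "w = (\<lambda>x. norm (x - \<mu>) powr (2 * \<alpha>))"
  define g :: "real ^ 'd \<Rightarrow> real" where "g = gvmf2_density \<alpha> \<kappa> \<mu>"
  define c where "c = gvmf2_const DIM(real ^ 'd) \<kappa> \<alpha>"
  define b where "b = - (\<kappa> / (2 powr \<alpha> * \<alpha>))"
  define F where "F = (\<lambda>x. enn2real (f x))"
  have g_eq: "g x = c * exp (b * w x)" for x
    by (simp add: g_def c_def b_def w_def gvmf2_density_def)
  have Z: "distributed N ?S Z (\<lambda>x. ennreal (g x))"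
    using assms(5) by (simp add: g_def)
  have X: "distributed M ?S X (\<lambda>x. ennreal (F x))"
    unfolding F_def by (rule distributed_enn2real) fact+
  have f[measurable]: "f \<in> borel_measurable ?S"
    using assms(7) by (simp add: distributed_def)
  have F[measurable]: "F \<in> borel_measurable ?S"
    by (simp add: F_def)
  have "w \<in> borel_measurable borel"
    unfolding w_def by measurable
  then have w[measurable]: "w \<in> borel_measurable ?S"
    by (simp add: measurable_cong_sets[OF sets_sphere_measure refl] measurable_restrict_space1)
  have g[measurable]: "g \<in> borel_measurable ?S"
    unfolding g_eq[abs_def] by measurable

  have w_bound: "\<bar>w x\<bar> \<le> 2 powr (2 * \<alpha>)" if "x \<in> space ?S" for x
  proof -
    have "norm (x - \<mu>) \<le> 2"
      using that assms(3) norm_triangle_ineq4[of x \<mu>] by simp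
    then show ?thesis
      using assms(2) by (simp add: w_def powr_mono2)
  qed

  \<comment> \<open>Otherwise the law of \<open>Z\<close> would be the null measure.\<close>
  have "c > 0"
  proof (rule ccontr)
    assume "\<not> c > 0"
    then have "ennreal (g x) = 0" for x
      by (simp add: g_eq ennreal_neg mult_nonpos_nonneg)
    then have "distr N ?S Z = density ?S (\<lambda>_. 0)"
      using Z by (simp add: distributed_def)
    then have "emeasure (distr N ?S Z) (space ?S) = 0"
      using emeasure_density[of "\<lambda>_. 0" ?S, OF _ sets.top] by simp
    moreover have "Z \<in> N \<rightarrow>\<^sub>M ?S"
      using Z by (simp add: distributed_def)
    then have "prob_space (distr N ?S Z)"
      by (rule N.prob_space_distr)
    then have "emeasure (distr N ?S Z) (space ?S) = 1"
      using prob_space.emeasure_space_1 by fastforce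
    ultimately show False by simp
  qed
  then have g_pos: "g x > 0" and ln_g: "ln (g x) = ln c + b * w x" for x
    by (auto simp: g_eq ln_mult)

  define m where "m = N.expectation (\<lambda>\<omega>. w (Z \<omega>))"
  have X_m: "M.expectation (\<lambda>\<omega>. w (X \<omega>)) = m"
    using assms(8) by (simp add: m_def w_def)

  have "has_bochner_integral ?S (\<lambda>x. g x * 1) (N.expectation (\<lambda>\<omega>. 1))"
    by (rule distributed_has_bochner_integral_bounded[where B = 1, OF \<open>prob_space N\<close> Z])
      (auto intro: less_imp_le g_pos)
  then have g_mass: "has_bochner_integral ?S g 1"
    by (simp add: N.prob_space)
  have "has_bochner_integral ?S (\<lambda>x. F x * 1) (M.expectation (\<lambda>\<omega>. 1))"
    by (rule distributed_has_bochner_integral_bounded[where B = 1, OF \<open>prob_space M\<close> X])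
      (auto simp: F_def)
  then have F_mass: "has_bochner_integral ?S F 1"
    by (simp add: M.prob_space)
  have g_w: "has_bochner_integral ?S (\<lambda>x. g x * w x) m"
    unfolding m_def
    by (rule distributed_has_bochner_integral_bounded[OF \<open>prob_space N\<close> Z g _ w w_bound])
      (auto intro: less_imp_le g_pos)
  have F_w: "has_bochner_integral ?S (\<lambda>x. F x * w x) m"
    unfolding X_m[symmetric]
    by (rule distributed_has_bochner_integral_bounded[OF \<open>prob_space M\<close> X F _ w w_bound])
      (auto simp: F_def)

  \<comment> \<open>As \<open>ln g\<close> is affine in \<open>w\<close>, the cross entropy only sees the mass and the moment of \<open>p\<close>.\<close>
  have cross: "has_bochner_integral ?S (\<lambda>x. p x * ln (g x)) (ln c + b * m)"
    if "has_bochner_integral ?S p 1" "has_bochner_integral ?S (\<lambda>x. p x * w x) m" for p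
  proof -
    have "has_bochner_integral ?S (\<lambda>x. ln c * p x + b * (p x * w x)) (ln c * 1 + b * m)"
      using that by (intro has_bochner_integral_add has_bochner_integral_mult_right)
    then show ?thesis
      by (simp add: ln_g algebra_simps)
  qed

  have "sphere_entropy M X = density_entropy f"
    by (rule sphere_entropy_eq) fact
  also have "\<dots> \<le> ereal (- (\<integral>x. F x * ln (g x) \<partial>?S))"
    unfolding F_def
    by (rule density_entropy_le_cross_entropy)
      (use F_mass g_mass g_pos cross[OF F_mass F_w] in
        \<open>auto simp: F_def has_bochner_integral_iff\<close>)
  also have "\<dots> = ereal (- (\<integral>x. g x * ln (g x) \<partial>?S))"
    using cross[OF F_mass F_w] cross[OF g_mass g_w] by (simp add: has_bochner_integral_iff)
  also have "\<dots> = density_entropy (\<lambda>x. ennreal (g x))"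
    using cross[OF g_mass g_w] g_pos
    by (subst density_entropy_integrable) (auto simp: has_bochner_integral_iff less_imp_le)
  also have "\<dots> = sphere_entropy N Z"
    using sphere_entropy_eq[OF Z] by simp
  finally show ?thesis .
qed

end
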